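(* Let $V=(V,+,\circ,K)$ be a hypervector space over a field $K$, and let $(F,A)$ and $(G,B)$ be bipolar fuzzy soft hypervector spaces of $V$. Then the sum $(F,A)+(G,B)$ is a bipolar fuzzy soft hypervector space of $V$.
   Context: Hypervector space: let $K$ be a field, $(V,+)$ an Abelian group, $P_*(V)$ the set of non-empty subsets of $V$. A hypervector space over $K$ is a quadruple $(V,+,\circ,K)$ with an external hyperoperation $\circ:K\times V\to P_*(V)$ such that for all $a,b\in K$, $x,y\in V$: (i) $a\circ(x+y)\subseteq a\circ x+a\circ y$; (ii) $(a+b)\circ x\subseteq a\circ x+b\circ x$; (iii) $a\circ(b\circ x)=(ab)\circ x$; (iv) $a\circ(-x)=(-a)\circ x=-(a\circ x)$; (v) $x\in 1\circ x$. Here, for subsets, $S+T=\{p+q: p\in S,q\in T\}$, $-S=\{-s:s\in S\}$, and $a\circ(b\circ x)=\bigcup_{t\in b\circ x}a\circ t$. Bipolar fuzzy soft set: let $E$ be a set of parameters and $A\subseteq E$. A bipolar fuzzy soft set $(F,A)$ over $V$ assigns to each $e\in A$ a pair of functions $F_e^+:V\to[0,1]$ and $F_e^-:V\to[-1,0]$. The parameter sets $A,B$ are subsets of a common $E$. Bipolar fuzzy soft hypervector space: $(F,A)$ is a bipolar fuzzy soft hypervector space of $V$ if for all $e\in A$, $x,y\in V$, $a\in K$: (1) $F_e^+(x-y)\ge F_e^+(x)\wedge F_e^+(y)$ and $F_e^-(x-y)\le F_e^-(x)\vee F_e^-(y)$; (2) $\bigwedge_{t\in a\circ x}F_e^+(t)\ge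 F_e^+(x)$ and $\bigvee_{t\in a\circ x}F_e^-(t)\le F_e^-(x)$. Here $\wedge,\vee$ (and $\bigwedge,\bigvee$) denote minimum and maximum (infimum and supremum) of real numbers. Sum: $(F,A)+(G,B)$ is the bipolar fuzzy soft set $(F+G,A\cap B)$ where, for $e\in A\cap B$ and $x\in V$, $$(F+G)^+_e(x)=\bigvee_{x=y+z}\bigl(F^+_e(y)\wedge G^+_e(z)\bigr),\qquad (F+G)^-_e(x)=\bigwedge_{x=y+z}\bigl(F^-_e(y)\vee G^-_e(z)\bigr),$$ the supremum and infimum being over all $(y,z)\in V\times V$ with $x=y+z$. *)

theory Defs
  imports Complex_Main "HOL-Library.Set_Algebras"
begin

text \<open>
  The Abelian group \<open>V\<close> and the field \<open>K\<close> are types of the corresponding classes. On sets,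
  \<open>+\<close> is the elementwise sum of \<open>Set_Algebras\<close>; the elementwise negative of a set \<open>S\<close> is written
  \<open>uminus ` S\<close>, because \<open>- S\<close> is the complement.
\<close>

locale hypervector_space =
  fixes hmult :: "'k::field \<Rightarrow> 'v::ab_group_add \<Rightarrow> 'v set"  (infixr "\<circ>\<^sub>h" 75)
  assumes hmult_nonempty: "a \<circ>\<^sub>h x \<noteq> {}"
    and hmult_add_right: "a \<circ>\<^sub>h (x + y) \<subseteq> (a \<circ>\<^sub>h x) + (a \<circ>\<^sub>h y)"
    and hmult_add_left: "(a + b) \<circ>\<^sub>h x \<subseteq> (a \<circ>\<^sub>h x) + (b \<circ>\<^sub>h x)"
    and hmult_assoc: "(\<Union>t \<in> b \<circ>\<^sub>h x. a \<circ>\<^sub>h t) = (a * b) \<circ>\<^sub>h x"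
    and hmult_minus_right: "a \<circ>\<^sub>h (- x) = (- a) \<circ>\<^sub>h x"
    and hmult_minus_left: "(- a) \<circ>\<^sub>h x = uminus ` (a \<circ>\<^sub>h x)"
    and hmult_one: "x \<in> 1 \<circ>\<^sub>h x"

text \<open>
  A pair \<open>(F, A)\<close>, where \<open>F e\<close> is the pair of the positive and the negative membership function
  at the parameter \<open>e\<close>. Values of \<open>F\<close> outside \<open>A\<close> carry no meaning and are never constrained.
\<close>

type_synonym ('e, 'v) bfss = "('e \<Rightarrow> ('v \<Rightarrow> real) \<times> ('v \<Rightarrow> real)) \<times> 'e set"

definition pos :: "('e, 'v) bfss \<Rightarrow> 'e \<Rightarrow> 'v \<Rightarrow> real" where
  "pos S e = fst (fst S e)"

definition neg :: "('e, 'v) bfss \<Rightarrow> 'e \<Rightarrow> 'v \<Rightarrow> real" where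
  "neg S e = snd (fst S e)"

definition params :: "('e, 'v) bfss \<Rightarrow> 'e set" where
  "params S = snd S"

definition bipolar_fuzzy_soft_set :: "'e set \<Rightarrow> ('e, 'v) bfss \<Rightarrow> bool" where
  "bipolar_fuzzy_soft_set E S \<longleftrightarrow>
     params S \<subseteq> E \<and>
     (\<forall>e\<in>params S. \<forall>x. pos S e x \<in> {0..1} \<and> neg S e x \<in> {-1..0})"

text \<open>
  The infima and suprema below are those of the conditionally complete order on \<open>real\<close>; they
  are taken over nonempty bounded sets, since hyperproducts are nonempty and membership functions
  take values in \<open>[0, 1]\<close> and \<open>[-1, 0]\<close>.
\<close>

definition bipolar_fuzzy_soft_hypervector_space ::
    "('k::field \<Rightarrow> 'v::ab_group_add \<Rightarrow> 'v set) \<Rightarrow> 'e set \<Rightarrow> ('e, 'v) bfss \<Rightarrow> bool" where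
  "bipolar_fuzzy_soft_hypervector_space hmult E S \<longleftrightarrow>
     bipolar_fuzzy_soft_set E S \<and>
     (\<forall>e\<in>params S. \<forall>x y.
        pos S e (x - y) \<ge> min (pos S e x) (pos S e y) \<and>
        neg S e (x - y) \<le> max (neg S e x) (neg S e y)) \<and>
     (\<forall>e\<in>params S. \<forall>a x.
        (INF t\<in>hmult a x. pos S e t) \<ge> pos S e x \<and>
        (SUP t\<in>hmult a x. neg S e t) \<le> neg S e x)"

definition bfss_sum ::
    "('e, 'v::ab_group_add) bfss \<Rightarrow> ('e, 'v) bfss \<Rightarrow> ('e, 'v) bfss"  (infixl "+\<^sub>b" 65) where
  "S +\<^sub>b T =
     ((\<lambda>e. (\<lambda>x. SUP (y, z)\<in>{(y, z). x = y + z}. min (pos S e y) (pos T e z),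
            \<lambda>x. INF (y, z)\<in>{(y, z). x = y + z}. max (neg S e y) (neg T e z))),
      params S \<inter> params T)"

end

theory Submission
  imports Defs
begin

text \<open>
  A decomposition \<open>x = y + z\<close> passes to \<open>x - x' = (y - y') + (z - z')\<close>, and, because
  \<open>a \<circ> (y + z) \<subseteq> a \<circ> y + a \<circ> z\<close>, to every \<open>t \<in> a \<circ> x\<close> as \<open>t = p + q\<close> with \<open>p \<in> a \<circ> y\<close> and
  \<open>q \<in> a \<circ> z\<close>. Each membership bound for the sum follows by comparing the suprema along such
  decompositions. The negative parts are reduced to the positive ones by negating membership
  functions, which turns an infimum of maxima into a supremum of minima.
\<close>

text \<open>The condition on hyperproducts is stated pointwise rather than with an infimum, so it
  can be used without boundedness or nonemptiness. One predicate serves both halves of a bipolar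
  set: it is applied to the positive part and to the negated negative part.\<close>

definition fuzzy_subspace ::
    "('k \<Rightarrow> 'v::ab_group_add \<Rightarrow> 'v set) \<Rightarrow> ('v \<Rightarrow> real) \<Rightarrow> bool" where
  "fuzzy_subspace hmult f \<longleftrightarrow>
     (\<forall>x y. min (f x) (f y) \<le> f (x - y)) \<and> (\<forall>a x. \<forall>t\<in>hmult a x. f x \<le> f t)"

definition fuzzy_sum ::
    "('v::ab_group_add \<Rightarrow> real) \<Rightarrow> ('v \<Rightarrow> real) \<Rightarrow> 'v \<Rightarrow> real" where
  "fuzzy_sum f g x = (SUP (y, z)\<in>{(y, z). x = y + z}. min (f y) (g z))"

lemma decompositions_nonempty: "{(y, z). x = y + z} \<noteq> {}" for x :: "'v::ab_group_add"
proof -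
  have "(x, 0) \<in> {(y, z). x = y + z}" by simp
  then show ?thesis by blast
qed

text \<open>A minimum never exceeds its first argument, so an upper bound of \<open>f\<close> bounds
  all the values.\<close>

lemma bdd_above_min_decompositions:
  fixes f g :: "'v::ab_group_add \<Rightarrow> real"
  assumes "bdd_above (range f)"
  shows "bdd_above ((\<lambda>(y, z). min (f y) (g z)) ` {(y, z). x = y + z})"
proof -
  obtain M where "\<And>y. f y \<le> M" using assms by (auto simp: bdd_above_def)
  then show ?thesis by (intro bdd_aboveI[where M = M]) (auto intro: min.coboundedI1)
qed

lemma min_le_fuzzy_sum:
  assumes "bdd_above (range f)"
  shows "min (f y) (g z) \<le> fuzzy_sum f g (y + z)"
  using cSUP_upper[OF _ bdd_above_min_decompositions[OF assms, of g "y + z"], of "(y, z)"]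
  by (simp add: fuzzy_sum_def)

text \<open>The supremum need not be attained, so decompositions are extracted only at levels
  \<open>c\<close> strictly below it.\<close>

lemma less_fuzzy_sumD:
  assumes "bdd_above (range f)" and "c < fuzzy_sum f g x"
  obtains y z where "x = y + z" "c < f y" "c < g z"
proof -
  have "\<exists>p\<in>{(y, z). x = y + z}. c < (case p of (y, z) \<Rightarrow> min (f y) (g z))"
    using assms(2) less_cSUP_iff[OF decompositions_nonempty bdd_above_min_decompositions[OF assms(1)]]
    unfolding fuzzy_sum_def by blast
  then show thesis using that by auto
qed

lemma fuzzy_sum_mem_Icc:
  assumes "\<And>x. f x \<in> {l..u}" and "\<And>x. g x \<in> {l..u}"
  shows "fuzzy_sum f g x \<in> {l..u}"
proof -
  have bdd: "bdd_above (range f)" using assms(1) by (auto intro!: bdd_aboveI[where M = u])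
  \<comment> \<open>The trivial decomposition \<open>x = x + 0\<close> already keeps the supremum
    above \<open>l\<close>.\<close>
  have "l \<le> min (f x) (g 0)" using assms by simp
  also have "\<dots> \<le> fuzzy_sum f g x" using min_le_fuzzy_sum[OF bdd, of x g 0] by simp
  finally have "l \<le> fuzzy_sum f g x" .
  moreover have "fuzzy_sum f g x \<le> u"
    unfolding fuzzy_sum_def using assms
    by (intro cSUP_least decompositions_nonempty) (auto intro: min.coboundedI1)
  ultimately show ?thesis by simp
qed

text \<open>On the reals \<open>Inf\<close> is defined as the negated \<open>Sup\<close> of the
  negated set, so the identity holds for arbitrary \<open>f\<close> and \<open>g\<close>; what
  remains is that negation turns \<open>max\<close> into \<open>min\<close>.\<close>

lemma INF_max_eq_uminus_fuzzy_sum: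
  "(INF (y, z)\<in>{(y, z). x = y + z}. max (f y) (g z)) =
     - fuzzy_sum (\<lambda>y. - f y) (\<lambda>z. - g z) x"
  for f :: "'v::ab_group_add \<Rightarrow> real"
  by (simp add: fuzzy_sum_def Inf_real_def image_image case_prod_unfold minus_max_eq_min)

lemma fuzzy_subspace_sum:
  assumes "hypervector_space hmult"
    and "fuzzy_subspace hmult f" and "fuzzy_subspace hmult g"
    and bdd: "bdd_above (range f)"
  shows "fuzzy_subspace hmult (fuzzy_sum f g)"
proof -
  interpret hypervector_space hmult by fact
  have f: "min (f x) (f y) \<le> f (x - y)" "t \<in> hmult a x \<Longrightarrow> f x \<le> f t"
    and g: "min (g x) (g y) \<le> g (x - y)" "t \<in> hmult a x \<Longrightarrow> g x \<le> g t" for a x y t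
    using assms(2,3) by (auto simp: fuzzy_subspace_def)
  have "min (fuzzy_sum f g x) (fuzzy_sum f g x') \<le> fuzzy_sum f g (x - x')" for x x'
  \<comment> \<open>Testing every \<open>c\<close> strictly below the left side avoids any need for
    optimal decompositions of \<open>x\<close> and \<open>x'\<close>.\<close>
  proof (rule dense_le)
    fix c assume "c < min (fuzzy_sum f g x) (fuzzy_sum f g x')"
    then have "c < fuzzy_sum f g x" "c < fuzzy_sum f g x'" by auto
    then obtain y z y' z' where x: "x = y + z" "c < f y" "c < g z"
      and x': "x' = y' + z'" "c < f y'" "c < g z'"
      using less_fuzzy_sumD[OF bdd] by metis
    have "c \<le> min (f (y - y')) (g (z - z'))"
      using x x' f(1)[of y y'] g(1)[of z z'] by auto
    also have "\<dots> \<le> fuzzy_sum f g ((y - y') + (z - z'))" by (rule min_le_fuzzy_sum[OF bdd])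
    also have "(y - y') + (z - z') = x - x'" using x x' by simp
    finally show "c \<le> fuzzy_sum f g (x - x')" .
  qed
  moreover have "fuzzy_sum f g x \<le> fuzzy_sum f g t" if t: "t \<in> hmult a x" for a x t
  proof (rule dense_le)
    fix c assume "c < fuzzy_sum f g x"
    then obtain y z where x: "x = y + z" "c < f y" "c < g z"
      using less_fuzzy_sumD[OF bdd] by metis
    have "t \<in> hmult a y + hmult a z" using t hmult_add_right x(1) by blast
    then obtain p q where pq: "t = p + q" "p \<in> hmult a y" "q \<in> hmult a z"
      by (rule set_plus_elim)
    have "c \<le> min (f p) (g q)" using x f(2)[OF pq(2)] g(2)[OF pq(3)] by simp
    also have "\<dots> \<le> fuzzy_sum f g t" unfolding pq(1) by (rule min_le_fuzzy_sum[OF bdd])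
    finally show "c \<le> fuzzy_sum f g t" .
  qed
  ultimately show ?thesis by (simp add: fuzzy_subspace_def)
qed

text \<open>Over a nonempty bounded set, a bound on an infimum or supremum is the same as a bound on
  each element. Hyperproducts are nonempty, and the ranges of the membership functions supply the
  boundedness.\<close>

lemma bipolar_fuzzy_soft_hypervector_space_iff:
  assumes "hypervector_space hmult"
  shows "bipolar_fuzzy_soft_hypervector_space hmult E S \<longleftrightarrow>
    bipolar_fuzzy_soft_set E S \<and>
    (\<forall>e\<in>params S. fuzzy_subspace hmult (pos S e) \<and> fuzzy_subspace hmult (\<lambda>x. - neg S e x))"
proof (cases "bipolar_fuzzy_soft_set E S")
  case True
  interpret hypervector_space hmult by fact
  have "pos S e x \<le> (INF t\<in>hmult a x. pos S e t) \<longleftrightarrow> (\<forall>t\<in>hmult a x. pos S e x \<le> pos S e t)"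
    "(SUP t\<in>hmult a x. neg S e t) \<le> neg S e x \<longleftrightarrow> (\<forall>t\<in>hmult a x. neg S e t \<le> neg S e x)"
    if "e \<in> params S" for e a x
  proof -
    \<comment> \<open>Zero serves for both: it is the lower end of [0, 1] and the upper end of
      [-1, 0].\<close>
    have "bdd_below (pos S e ` hmult a x)" "bdd_above (neg S e ` hmult a x)"
      using True that unfolding bipolar_fuzzy_soft_set_def
      by (auto intro!: bdd_belowI[where m = 0] bdd_aboveI[where M = 0])
    then show "pos S e x \<le> (INF t\<in>hmult a x. pos S e t) \<longleftrightarrow> (\<forall>t\<in>hmult a x. pos S e x \<le> pos S e t)"
      "(SUP t\<in>hmult a x. neg S e t) \<le> neg S e x \<longleftrightarrow> (\<forall>t\<in>hmult a x. neg S e t \<le> neg S e x)"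
      by (simp_all add: le_cINF_iff cSUP_le_iff hmult_nonempty)
  qed
  moreover have "min (- neg S e x) (- neg S e y) \<le> - neg S e (x - y) \<longleftrightarrow>
      neg S e (x - y) \<le> max (neg S e x) (neg S e y)" for e x y
    by (auto simp: min_def max_def)
  ultimately show ?thesis
    unfolding bipolar_fuzzy_soft_hypervector_space_def fuzzy_subspace_def
    using True by auto
qed (simp add: bipolar_fuzzy_soft_hypervector_space_def)

lemma params_bfss_sum: "params (S +\<^sub>b T) = params S \<inter> params T"
  by (simp add: bfss_sum_def params_def)

lemma pos_bfss_sum: "pos (S +\<^sub>b T) e = fuzzy_sum (pos S e) (pos T e)"
  by (simp add: bfss_sum_def pos_def fuzzy_sum_def fun_eq_iff)

lemma neg_bfss_sum:
  "neg (S +\<^sub>b T) e x = - fuzzy_sum (\<lambda>y. - neg S e y) (\<lambda>z. - neg T e z) x"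
  unfolding INF_max_eq_uminus_fuzzy_sum[symmetric] by (simp add: bfss_sum_def neg_def)

lemma bipolar_fuzzy_soft_set_sum:
  assumes "bipolar_fuzzy_soft_set E S" and "bipolar_fuzzy_soft_set E T"
  shows "bipolar_fuzzy_soft_set E (S +\<^sub>b T)"
proof -
  have "pos (S +\<^sub>b T) e x \<in> {0..1} \<and> neg (S +\<^sub>b T) e x \<in> {-1..0}"
    if "e \<in> params S" "e \<in> params T" for e x
    \<comment> \<open>Negation carries [-1, 0] onto [0, 1], so the same interval is used for both
      parts.\<close>
    using assms that fuzzy_sum_mem_Icc[of "pos S e" 0 1 "pos T e" x]
      fuzzy_sum_mem_Icc[of "\<lambda>y. - neg S e y" 0 1 "\<lambda>y. - neg T e y" x]
    by (force simp: bipolar_fuzzy_soft_set_def pos_bfss_sum neg_bfss_sum)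
  then show ?thesis using assms by (auto simp: bipolar_fuzzy_soft_set_def params_bfss_sum)
qed

theorem proposition4p8:
  fixes hmult :: "'k::field \<Rightarrow> 'v::ab_group_add \<Rightarrow> 'v set"
    and E A B :: "'e set"
    and F G :: "'e \<Rightarrow> ('v \<Rightarrow> real) \<times> ('v \<Rightarrow> real)"
  assumes "hypervector_space hmult"
    and "bipolar_fuzzy_soft_hypervector_space hmult E (F, A)"
    and "bipolar_fuzzy_soft_hypervector_space hmult E (G, B)"
  shows "bipolar_fuzzy_soft_hypervector_space hmult E ((F, A) +\<^sub>b (G, B))"
proof -
  let ?S = "(F, A)" and ?T = "(G, B)"
  note iff = bipolar_fuzzy_soft_hypervector_space_iff[OF assms(1)]
  have S: "bipolar_fuzzy_soft_set E ?S" and T: "bipolar_fuzzy_soft_set E ?T"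
    using assms(2,3) by (simp_all add: iff)
  have "fuzzy_subspace hmult (pos (?S +\<^sub>b ?T) e) \<and>
      fuzzy_subspace hmult (\<lambda>x. - neg (?S +\<^sub>b ?T) e x)"
    if e: "e \<in> params ?S" "e \<in> params ?T" for e
  proof -
    have "bdd_above (range (pos ?S e))"
      using S e by (auto simp: bipolar_fuzzy_soft_set_def intro!: bdd_aboveI[where M = 1])
    moreover have "-1 \<le> neg ?S e x" for x
      using S e by (simp add: bipolar_fuzzy_soft_set_def)
    then have "bdd_above (range (\<lambda>x. - neg ?S e x))"
      by (intro bdd_aboveI[where M = 1]) (auto simp: minus_le_iff)
    ultimately show ?thesis
      \<comment> \<open>Rewriting with \<open>neg_bfss_sum\<close> leaves a double negation; once it
        cancels, the second conjunct concerns the \<open>fuzzy_sum\<close> of the negated negative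
        parts, and \<open>fuzzy_subspace_sum\<close> covers both conjuncts.\<close>
      using assms(2,3) e by (simp add: iff pos_bfss_sum neg_bfss_sum fuzzy_subspace_sum[OF assms(1)])
  qed
  then show ?thesis
    using bipolar_fuzzy_soft_set_sum[OF S T] by (simp add: iff params_bfss_sum)
qed

end
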